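(* Let $\alpha>0$ and let $\boldsymbol{\mathcal R}\subseteq 2^{[m]}$ be a random collection of rejection sets. Then $\boldsymbol{\mathcal R}$ simultaneously controls the false discovery rate at level $\alpha$, i.e. $\mathbb E_{\mathrm P}\big(\max_{R\in\boldsymbol{\mathcal R}}\mathrm{FDP}_{N_{\mathrm P}}(R)\big)\le\alpha$ for every $\mathrm P\in M$, if and only if $\boldsymbol{\mathcal R}\subseteq\mathcal R^{\mathrm{FDR}}_\alpha(\mathbf E)$ for some e-collection $\mathbf E=(\mathbf e_S)_{S\in 2^{[m]}}$, where $$\mathcal R^{\mathrm{FDR}}_\alpha(\mathbf E)=\Big\{R\in 2^{[m]}:\ \mathbf e_S\ge\frac{\mathrm{FDP}_S(R)}{\alpha}\ \text{ for all }S\in 2^{[m]}\Big\}.$$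
   Context: Setting: $M$ is a set of probability measures on a measurable space; $m\ge 1$, $[m]=\{1,\dots,m\}$; hypotheses $H_1,\dots,H_m$ are subsets of $M$; for $\mathrm P\in M$, $N_{\mathrm P}=\{i\in[m]:\mathrm P\in H_i\}$. Random variables and random collections (values in $2^{2^{[m]}}$) are measurable functions on this space; inequalities and inclusions between random objects are understood to hold $\mathrm P$-almost surely for every $\mathrm P\in M$. Random collections $\boldsymbol{\mathcal R}$ are assumed to be never empty (without loss, since $\emptyset$ may always be added to them). $\mathrm{FDP}_N(R)=|R\cap N|/(|R|\vee1)$. An e-collection is a family $\mathbf E=(\mathbf e_S)_{S\in 2^{[m]}}$ of nonnegative random variables with $\mathbb E_{\mathrm P}(\mathbf e_{N_{\mathrm P}})\le 1$ for all $\mathrm P\in M$; by convention $\mathbf e_\emptyset=0$. *)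

theory Defs
  imports "HOL-Probability.Probability"
begin

definition true_hyps :: "nat \<Rightarrow> (nat \<Rightarrow> 'a measure set) \<Rightarrow> 'a measure \<Rightarrow> nat set" where
  "true_hyps m H P = {i \<in> {1..m}. P \<in> H i}"

definition FDP :: "nat set \<Rightarrow> nat set \<Rightarrow> real" where
  "FDP N R = real (card (R \<inter> N)) / max (real (card R)) 1"

text \<open>The space \<open>\<Omega>\<close> only supplies the measurable structure; its own measure is irrelevant.\<close>

definition random_collection :: "'a measure \<Rightarrow> nat \<Rightarrow> ('a \<Rightarrow> nat set set) \<Rightarrow> bool" where
  "random_collection \<Omega> m \<R> \<longleftrightarrow>
     \<R> \<in> \<Omega> \<rightarrow>\<^sub>M count_space (Pow (Pow {1..m})) \<and> (\<forall>\<omega>\<in>space \<Omega>. \<R> \<omega> \<noteq> {})"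

text \<open>Integrability has to be required explicitly, since the Bochner integral of a
  non-integrable function is 0. For a nonnegative variable it says that the expectation is finite.\<close>

definition e_collection ::
    "'a measure \<Rightarrow> 'a measure set \<Rightarrow> nat \<Rightarrow> (nat \<Rightarrow> 'a measure set) \<Rightarrow> (nat set \<Rightarrow> 'a \<Rightarrow> real) \<Rightarrow> bool" where
  "e_collection \<Omega> M m H E \<longleftrightarrow>
     (\<forall>S\<in>Pow {1..m}. E S \<in> borel_measurable \<Omega> \<and> (\<forall>P\<in>M. AE \<omega> in P. 0 \<le> E S \<omega>)) \<and>
     (\<forall>\<omega>\<in>space \<Omega>. E {} \<omega> = 0) \<and>
     (\<forall>P\<in>M. integrable P (E (true_hyps m H P)) \<and> (LINT \<omega>|P. E (true_hyps m H P) \<omega>) \<le> 1)"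

text \<open>A maximum over a finite nonempty set of numbers in \<open>{0..1}\<close>, so the integrand below is
  bounded and the Bochner integral is the expectation.\<close>

definition simultaneous_FDR_control ::
    "'a measure set \<Rightarrow> nat \<Rightarrow> (nat \<Rightarrow> 'a measure set) \<Rightarrow> real \<Rightarrow> ('a \<Rightarrow> nat set set) \<Rightarrow> bool" where
  "simultaneous_FDR_control M m H \<alpha> \<R> \<longleftrightarrow>
     (\<forall>P\<in>M. (LINT \<omega>|P. (MAX R\<in>\<R> \<omega>. FDP (true_hyps m H P) R)) \<le> \<alpha>)"

text \<open>The argument \<open>e\<close> is a realisation \<open>\<lambda>S. E S \<omega>\<close> of an e-collection \<open>E\<close>.\<close>

definition FDR_collection :: "nat \<Rightarrow> real \<Rightarrow> (nat set \<Rightarrow> real) \<Rightarrow> nat set set" where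
  "FDR_collection m \<alpha> e = {R \<in> Pow {1..m}. \<forall>S\<in>Pow {1..m}. e S \<ge> FDP S R / \<alpha>}"

end

(* The canonical e-collection for a controlling random collection is the rescaled maximal FDP,
   E S = (max over R of FDP S R) / alpha; its expectation at S = true_hyps m H P is at most 1
   precisely when FDR control holds. Conversely, if every R in the collection satisfies
   FDP S R <= alpha * E S for all S, then the maximal FDP is dominated by alpha * E S, and
   taking S = true_hyps m H P and expectations gives the bound alpha. *)

theory Submission
  imports Defs
begin

lemma FDP_nonneg: "0 \<le> FDP N R"
  by (simp add: FDP_def)

lemma FDP_le_1:
  assumes "finite R"
  shows "FDP N R \<le> 1"
proof -
  have "card (R \<inter> N) \<le> card R"
    using assms by (intro card_mono) auto
  then show ?thesis
    by (simp add: FDP_def)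
qed

lemma FDP_empty: "FDP {} R = 0"
  by (simp add: FDP_def)

context
  fixes \<Omega> :: "'a measure" and m :: nat and \<R> :: "'a \<Rightarrow> nat set set"
  assumes coll: "random_collection \<Omega> m \<R>"
begin

lemma random_collection_subset: "\<omega> \<in> space \<Omega> \<Longrightarrow> \<R> \<omega> \<subseteq> Pow {1..m}"
  using coll measurable_space[of \<R> \<Omega> "count_space (Pow (Pow {1..m}))"]
  unfolding random_collection_def by (simp add: Pow_iff)

lemma random_collection_finite: "\<omega> \<in> space \<Omega> \<Longrightarrow> finite (\<R> \<omega>)"
  by (rule finite_subset[OF random_collection_subset]) auto

lemma random_collection_nonempty: "\<omega> \<in> space \<Omega> \<Longrightarrow> \<R> \<omega> \<noteq> {}"
  using coll unfolding random_collection_def by blast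

lemma Max_FDP_ge: "\<omega> \<in> space \<Omega> \<Longrightarrow> R \<in> \<R> \<omega> \<Longrightarrow> FDP S R \<le> (MAX R\<in>\<R> \<omega>. FDP S R)"
  using random_collection_finite by (intro Max_ge) auto

text \<open>Finiteness and nonemptiness of \<open>\<R> \<omega>\<close> make the maximum an attained
  value, since \<open>Max\<close> is unspecified on the empty set. Read from right to left, this
  turns a bound on each rejection set into a bound on the maximum.\<close>

lemma Max_FDP_le_iff:
  "\<omega> \<in> space \<Omega> \<Longrightarrow> (MAX R\<in>\<R> \<omega>. FDP S R) \<le> c \<longleftrightarrow> (\<forall>R\<in>\<R> \<omega>. FDP S R \<le> c)"
  using random_collection_finite random_collection_nonempty by (subst Max_le_iff) auto

lemma Max_FDP_nonneg:
  assumes "\<omega> \<in> space \<Omega>"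
  shows "0 \<le> (MAX R\<in>\<R> \<omega>. FDP S R)"
proof -
  obtain R where "R \<in> \<R> \<omega>"
    using random_collection_nonempty[OF assms] by blast
  then show ?thesis
    using Max_FDP_ge[OF assms] FDP_nonneg order_trans by blast
qed

lemma Max_FDP_le_1:
  assumes "\<omega> \<in> space \<Omega>"
  shows "(MAX R\<in>\<R> \<omega>. FDP S R) \<le> 1"
proof -
  have "finite R" if "R \<in> \<R> \<omega>" for R
    using random_collection_subset[OF assms] that finite_subset[of R "{1..m}"] by blast
  then show ?thesis
    using Max_FDP_le_iff[OF assms] FDP_le_1 by blast
qed

text \<open>The maximum depends on \<open>\<omega>\<close> only through the value
  \<open>\<R> \<omega>\<close>, which lies in a discrete space, and every function out of a discrete
  space is measurable.\<close>

lemma Max_FDP_measurable: "(\<lambda>\<omega>. MAX R\<in>\<R> \<omega>. FDP S R) \<in> borel_measurable \<Omega>"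
proof (rule measurable_compose[where g = "\<lambda>A. MAX R\<in>A. FDP S R"])
  show "\<R> \<in> \<Omega> \<rightarrow>\<^sub>M count_space (Pow (Pow {1..m}))"
    using coll unfolding random_collection_def by blast
  show "(\<lambda>A. MAX R\<in>A. FDP S R) \<in> borel_measurable (count_space (Pow (Pow {1..m})))"
    by simp
qed

text \<open>The maximum lies between 0 and 1 and \<open>P\<close> is a probability measure;
  measurability carries over because \<open>P\<close> has the same measurable sets as
  \<open>\<Omega>\<close>.\<close>

lemma Max_FDP_integrable:
  assumes "P \<in> space (prob_algebra \<Omega>)"
  shows "integrable P (\<lambda>\<omega>. MAX R\<in>\<R> \<omega>. FDP S R)"
proof -
  have sets: "sets P = sets \<Omega>" and "prob_space P"
    using assms by (auto simp: space_prob_algebra)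
  interpret prob_space P by fact
  have space: "space P = space \<Omega>"
    using sets by (rule sets_eq_imp_space_eq)
  show ?thesis
  proof (rule integrable_const_bound)
    show "AE \<omega> in P. norm (MAX R\<in>\<R> \<omega>. FDP S R) \<le> 1"
      using Max_FDP_nonneg Max_FDP_le_1 by (intro AE_I2) (simp add: space)
    show "(\<lambda>\<omega>. MAX R\<in>\<R> \<omega>. FDP S R) \<in> borel_measurable P"
      using Max_FDP_measurable by (simp only: measurable_cong_sets[OF sets refl])
  qed
qed

end

theorem theorem14:
  fixes \<Omega> :: "'a measure" and M :: "'a measure set" and H :: "nat \<Rightarrow> 'a measure set"
    and m :: nat and \<alpha> :: real and \<R> :: "'a \<Rightarrow> nat set set"
  assumes "M \<subseteq> space (prob_algebra \<Omega>)"
    and "m \<ge> 1"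
    and "\<And>i. i \<in> {1..m} \<Longrightarrow> H i \<subseteq> M"
    and "\<alpha> > 0"
    and "random_collection \<Omega> m \<R>"
  shows "simultaneous_FDR_control M m H \<alpha> \<R> \<longleftrightarrow>
    (\<exists>E. e_collection \<Omega> M m H E \<and>
       (\<forall>P\<in>M. AE \<omega> in P. \<R> \<omega> \<subseteq> FDR_collection m \<alpha> (\<lambda>S. E S \<omega>)))"
proof
  note coll = \<open>random_collection \<Omega> m \<R>\<close>
  \<comment> \<open>The facts about \<open>\<R>\<close> are stated on \<open>space \<Omega>\<close>,
    while almost-sure statements range over \<open>space P\<close>.\<close>
  have space: "space P = space \<Omega>" if "P \<in> M" for P
  proof (rule sets_eq_imp_space_eq)
    show "sets P = sets \<Omega>"
      using assms(1) that by (auto simp: space_prob_algebra)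
  qed
  have integrable: "integrable P (\<lambda>\<omega>. MAX R\<in>\<R> \<omega>. FDP S R)" if "P \<in> M" for P S
    using Max_FDP_integrable[OF coll] assms(1) that by blast
  {
    assume control: "simultaneous_FDR_control M m H \<alpha> \<R>"
    \<comment> \<open>The pointwise smallest choice: \<open>E S \<omega>\<close> dominates
      \<open>FDP S R / \<alpha>\<close> for all \<open>R\<close> in \<open>\<R> \<omega>\<close> and
      equals it for a maximising \<open>R\<close>.\<close>
    define E where "E = (\<lambda>S \<omega>. (MAX R\<in>\<R> \<omega>. FDP S R) / \<alpha>)"
    have "e_collection \<Omega> M m H E"
      unfolding e_collection_def
    proof (intro conjI ballI)
      fix S
      show "E S \<in> borel_measurable \<Omega>"
        unfolding E_def using Max_FDP_measurable[OF coll] by (rule borel_measurable_divide) simp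
      show "AE \<omega> in P. 0 \<le> E S \<omega>" if "P \<in> M" for P
        using \<open>\<alpha> > 0\<close> Max_FDP_nonneg[OF coll] space[OF that] by (auto simp: E_def)
    next
      fix \<omega> assume "\<omega> \<in> space \<Omega>"
      \<comment> \<open>\<open>FDP {}\<close> vanishes identically, so the maximum runs over
        \<open>{0}\<close>; this uses that \<open>\<R> \<omega>\<close> is nonempty.\<close>
      then show "E {} \<omega> = 0"
        using random_collection_nonempty[OF coll] by (simp add: E_def FDP_empty image_constant_conv)
    next
      fix P assume "P \<in> M"
      then show "integrable P (E (true_hyps m H P))"
        unfolding E_def using integrable by (intro integrable_divide) auto
      have "(LINT \<omega>|P. (MAX R\<in>\<R> \<omega>. FDP (true_hyps m H P) R)) \<le> \<alpha>"
        using control \<open>P \<in> M\<close> unfolding simultaneous_FDR_control_def by blast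
      then show "(LINT \<omega>|P. E (true_hyps m H P) \<omega>) \<le> 1"
        using \<open>\<alpha> > 0\<close> by (simp add: E_def)
    qed
    \<comment> \<open>For this \<open>E\<close> the inclusion holds at every point of the space,
      hence almost surely under each \<open>P\<close>.\<close>
    moreover have "AE \<omega> in P. \<R> \<omega> \<subseteq> FDR_collection m \<alpha> (\<lambda>S. E S \<omega>)" if "P \<in> M" for P
    proof (rule AE_I2)
      fix \<omega> assume "\<omega> \<in> space P"
      then have \<omega>: "\<omega> \<in> space \<Omega>"
        using space[OF that] by simp
      show "\<R> \<omega> \<subseteq> FDR_collection m \<alpha> (\<lambda>S. E S \<omega>)"
        using random_collection_subset[OF coll \<omega>] Max_FDP_ge[OF coll \<omega>] \<open>\<alpha> > 0\<close>
        by (auto simp: FDR_collection_def E_def intro!: divide_right_mono)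
    qed
    ultimately show "\<exists>E. e_collection \<Omega> M m H E \<and>
        (\<forall>P\<in>M. AE \<omega> in P. \<R> \<omega> \<subseteq> FDR_collection m \<alpha> (\<lambda>S. E S \<omega>))"
      by blast
  }
  assume "\<exists>E. e_collection \<Omega> M m H E \<and>
      (\<forall>P\<in>M. AE \<omega> in P. \<R> \<omega> \<subseteq> FDR_collection m \<alpha> (\<lambda>S. E S \<omega>))"
  then obtain E where E: "e_collection \<Omega> M m H E"
    and sub: "\<And>P. P \<in> M \<Longrightarrow> AE \<omega> in P. \<R> \<omega> \<subseteq> FDR_collection m \<alpha> (\<lambda>S. E S \<omega>)"
    by blast
  show "simultaneous_FDR_control M m H \<alpha> \<R>"
    unfolding simultaneous_FDR_control_def
  proof
    fix P assume P: "P \<in> M"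
    let ?N = "true_hyps m H P"
    \<comment> \<open>\<open>FDR_collection\<close> constrains \<open>E S\<close> only for
      \<open>S\<close> within \<open>{1..m}\<close>, so this membership is what permits the choice
      of \<open>?N\<close> for \<open>S\<close>.\<close>
    have N: "?N \<in> Pow {1..m}"
      by (auto simp: true_hyps_def)
    have int: "integrable P (E ?N)" and le1: "(LINT \<omega>|P. E ?N \<omega>) \<le> 1"
      using E P unfolding e_collection_def by blast+
    have "AE \<omega> in P. (MAX R\<in>\<R> \<omega>. FDP ?N R) \<le> \<alpha> * E ?N \<omega>"
      using sub[OF P]
    proof (rule AE_mp, intro AE_I2 impI)
      fix \<omega>
      assume "\<omega> \<in> space P" and R: "\<R> \<omega> \<subseteq> FDR_collection m \<alpha> (\<lambda>S. E S \<omega>)"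
      then have "\<omega> \<in> space \<Omega>"
        using space[OF P] by simp
      moreover have "FDP ?N R \<le> \<alpha> * E ?N \<omega>" if "R \<in> \<R> \<omega>" for R
      proof -
        have "FDP ?N R / \<alpha> \<le> E ?N \<omega>"
          using R N that unfolding FDR_collection_def by blast
        then show ?thesis
          using \<open>\<alpha> > 0\<close> by (simp add: pos_divide_le_eq mult.commute)
      qed
      ultimately show "(MAX R\<in>\<R> \<omega>. FDP ?N R) \<le> \<alpha> * E ?N \<omega>"
        using Max_FDP_le_iff[OF coll] by blast
    qed
    \<comment> \<open>Monotonicity of the Bochner integral requires both sides to be integrable: the
      left is bounded, the right is integrable by the definition of an e-collection.\<close>
    then have "(LINT \<omega>|P. (MAX R\<in>\<R> \<omega>. FDP ?N R)) \<le> (LINT \<omega>|P. \<alpha> * E ?N \<omega>)"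
      using integrable[OF P] int by (intro integral_mono_AE) auto
    also have "\<dots> \<le> \<alpha>"
      using le1 \<open>\<alpha> > 0\<close> by simp
    finally show "(LINT \<omega>|P. (MAX R\<in>\<R> \<omega>. FDP ?N R)) \<le> \<alpha>" .
  qed
qed

end
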